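(* Let $X, Y$ be Banach spaces and $U$ an open convex subset of $X$. Suppose that $f:U\to Y$ is continuous and $Jf$ is a pseudo-Jacobian mapping for $f$ on $U$. Then, for each $u,v\in U$, $$f(v)-f(u)\in \overline{\mathrm{co}}\,\bigl(Jf([u,v])(v-u)\bigr),$$ where $Jf([u,v])(v-u)=\{T(v-u) : T\in Jf(z),\ z\in[u,v]\}$ and $\overline{\mathrm{co}}$ denotes the norm-closed convex hull in $Y$.
   Context: Banach spaces are real; $\mathcal{L}(X,Y)$ is the space of bounded linear operators from $X$ to $Y$; $[u,v]$ is the segment joining $u$ and $v$. For $\varphi:U\to\mathbb{R}$ with $U\subset X$ open, $x\in U$ and $v\in X$, the upper right-hand Dini derivative is $\varphi'_{+}(x;v)=\limsup_{t\to0^+}\frac{\varphi(x+tv)-\varphi(x)}{t}$. For a map $f:U\to Y$ and $x\in U$, a nonempty set $Jf(x)\subset\mathcal{L}(X,Y)$ is a pseudo-Jacobian of $f$ at $x$ if $(y^*\circ f)'_{+}(x;v)\le\sup\{\langle y^*,T(v)\rangle : T\in Jf(x)\}$ for all $y^*\in Y^*$ and $v\in X$. A set-valued mapping $Jf:U\to2^{\mathcal{L}(X,Y)}$ is a pseudo-Jacobian mapping for $f$ on $U$ if $Jf(x)$ is a pseudo-Jacobian of $f$ at $x$ for every $x\in U$. *)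

theory Defs
  imports "HOL-Analysis.Analysis"
begin

text \<open>
  Maps on an open set \<open>U\<close> are total functions; only their values on \<open>U\<close> matter. In particular the
  upper Dini derivative at a point of an open set \<open>U\<close> depends only on the values on \<open>U\<close>, because
  \<open>x + t v\<close> lies in \<open>U\<close> for all small \<open>t > 0\<close>. The upper limit and the supremum below are
  extended real numbers, as both may be infinite.
\<close>

definition upper_dini :: "('a::real_normed_vector \<Rightarrow> real) \<Rightarrow> 'a \<Rightarrow> 'a \<Rightarrow> ereal" where
  "upper_dini \<phi> x v = Limsup (at_right 0) (\<lambda>t. ereal ((\<phi> (x + t *\<^sub>R v) - \<phi> x) / t))"

definition pseudo_jacobian ::
  "('a::real_normed_vector \<Rightarrow> 'b::real_normed_vector) \<Rightarrow> 'a \<Rightarrow> ('a \<Rightarrow>\<^sub>L 'b) set \<Rightarrow> bool" where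
  "pseudo_jacobian f x J \<longleftrightarrow> J \<noteq> {} \<and>
     (\<forall>(y :: 'b \<Rightarrow>\<^sub>L real) v.
        upper_dini (blinfun_apply y \<circ> f) x v
          \<le> (SUP T\<in>J. ereal (blinfun_apply y (blinfun_apply T v))))"

definition pseudo_jacobian_mapping ::
  "'a::real_normed_vector set \<Rightarrow> ('a \<Rightarrow> 'b::real_normed_vector) \<Rightarrow> ('a \<Rightarrow> ('a \<Rightarrow>\<^sub>L 'b) set) \<Rightarrow> bool" where
  "pseudo_jacobian_mapping U f Jf \<longleftrightarrow> (\<forall>x\<in>U. pseudo_jacobian f x (Jf x))"

end

theory Submission
  imports Defs
begin

text \<open>
  A point of a normed space that lies outside a closed convex set can be cut off from it by a
  continuous linear functional. So suppose that \<open>f v - f u\<close> is not in the closed convex hull \<open>K\<close> of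
  the vectors \<open>T (v - u)\<close>. Then some functional \<open>y\<close> satisfies \<open>y k \<le> y (f v - f u) - d\<close> on \<open>K\<close>, with
  \<open>d > 0\<close>. Restrict \<open>y \<circ> f\<close> to the segment, as a function of \<open>t \<in> [0,1]\<close>. The definition of a
  pseudo-Jacobian bounds the upper right Dini derivative of this continuous real function, at
  every \<open>t < 1\<close>, by the constant \<open>y (f v - f u) - d\<close>. A continuous function whose Dini derivative is
  bounded by \<open>M\<close> grows at most at rate \<open>M\<close> (\<open>upper_dini_mean_value\<close>), so \<open>y (f v - f u)\<close> is at most
  \<open>y (f v - f u) - d\<close>, which is absurd.

  The separation (\<open>convex_norm_functional\<close>) is derived from the Hahn--Banach theorem in the form
  \<open>sublinear_dominates_linear\<close>: below every sublinear functional there is a linear one. The linear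
  functional is a minimal element among the sublinear ones. All sublinear functionals needed on
  the way are pointwise infima of families, and \<open>sublinear_INF\<close> treats them together.
\<close>

section \<open>Sublinear functionals and the Hahn--Banach theorem\<close>

definition sublinear :: "('a::real_vector \<Rightarrow> real) \<Rightarrow> bool" where
  "sublinear p \<longleftrightarrow> (\<forall>x y. p (x + y) \<le> p x + p y) \<and> (\<forall>c>0. \<forall>x. p (c *\<^sub>R x) = c * p x)"

lemma sublinear_add: "sublinear p \<Longrightarrow> p (x + y) \<le> p x + p y"
  by (simp add: sublinear_def)

lemma sublinear_zero:
  assumes "sublinear p"
  shows "p 0 = 0"
proof -
  have "p ((2::real) *\<^sub>R 0) = 2 * p 0"
    using assms unfolding sublinear_def by (metis zero_less_numeral)
  then show ?thesis by simp
qed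

lemma sublinear_scale:
  assumes "sublinear p" "c \<ge> 0"
  shows "p (c *\<^sub>R x) = c * p x"
  using assms sublinear_zero[OF assms(1)] by (cases "c = 0") (auto simp: sublinear_def)

lemma sublinear_ge_uminus:
  assumes "sublinear p"
  shows "- p (- x) \<le> p x"
  using sublinear_add[OF assms, of x "- x"] sublinear_zero[OF assms] by simp

text \<open>
  An estimate for a sum or a multiple may move to another index of the family: the infimum absorbs
  the change. This covers chains of sublinear functionals as well as families of translates of one
  functional.
\<close>

lemma sublinear_INF:
  fixes F :: "'i \<Rightarrow> 'a::real_vector \<Rightarrow> real"
  assumes ne: "I \<noteq> {}"
    and bdd: "\<And>x. bdd_below ((\<lambda>i. F i x) ` I)"
    and add: "\<And>i j x y. i \<in> I \<Longrightarrow> j \<in> I \<Longrightarrow> \<exists>k\<in>I. F k (x + y) \<le> F i x + F j y"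
    and scale: "\<And>i c x. i \<in> I \<Longrightarrow> c > 0 \<Longrightarrow> \<exists>k\<in>I. F k (c *\<^sub>R x) \<le> c * F i x"
  shows "sublinear (\<lambda>x. INF i\<in>I. F i x)"
proof -
  let ?P = "\<lambda>x. INF i\<in>I. F i x"
  have sub: "?P (x + y) \<le> ?P x + ?P y" for x y
  proof -
    have ij: "?P (x + y) \<le> F i x + F j y" if "i \<in> I" "j \<in> I" for i j
      using add[OF that, of x y] cINF_lower[OF bdd] by (meson order_trans)
    have "?P (x + y) - F i x \<le> ?P y" if "i \<in> I" for i
      using ne ij[OF that] by (intro cINF_greatest) (auto simp: algebra_simps)
    then have "?P (x + y) - ?P y \<le> ?P x"
      using ne by (intro cINF_greatest) (auto simp: algebra_simps)
    then show ?thesis by simp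
  qed
  have le: "?P (c *\<^sub>R x) \<le> c * ?P x" if c: "c > 0" for c x
  proof -
    have "?P (c *\<^sub>R x) \<le> c * F i x" if "i \<in> I" for i
      using scale[OF that c, of x] cINF_lower[OF bdd] by (meson order_trans)
    then have "?P (c *\<^sub>R x) / c \<le> ?P x"
      using ne c by (intro cINF_greatest) (auto simp: field_simps)
    then show ?thesis using c by (simp add: field_simps)
  qed
  have "?P (c *\<^sub>R x) = c * ?P x" if c: "c > 0" for c x
  proof (rule antisym[OF le[OF c]])
    \<comment> \<open>The reverse inequality is the first one for the factor \<open>1 / c\<close>.\<close>
    have "?P (inverse c *\<^sub>R (c *\<^sub>R x)) \<le> inverse c * ?P (c *\<^sub>R x)"
      using c by (intro le) simp
    then show "c * ?P x \<le> ?P (c *\<^sub>R x)" using c by (simp add: field_simps)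
  qed
  with sub show ?thesis unfolding sublinear_def by blast
qed

text \<open>
  Every sublinear functional \<open>q \<le> p\<close> satisfies \<open>q x \<ge> - q (- x) \<ge> - p (- x)\<close>. This is why pointwise
  infima of chains are finite and Zorn's lemma applies downwards.
\<close>

lemma minimal_sublinear_exists:
  fixes p :: "'a::real_vector \<Rightarrow> real"
  assumes p: "sublinear p"
  obtains q where "sublinear q" "q \<le> p" "\<And>r. sublinear r \<Longrightarrow> r \<le> q \<Longrightarrow> r = q"
proof -
  let ?A = "{q. sublinear q \<and> q \<le> p}"
  let ?P = "\<lambda>a b :: 'a \<Rightarrow> real. b \<le> a"
  have "\<exists>m\<in>?A. \<forall>a\<in>?A. ?P m a \<longrightarrow> a = m"
  proof (rule predicate_Zorn)
    show "partial_order_on ?A (relation_of ?P ?A)"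
      by (rule partial_order_on_relation_ofI) auto
  next
    fix C assume "C \<in> Chains (relation_of ?P ?A)"
    then have CA: "C \<subseteq> ?A" and ch: "\<And>a b. a \<in> C \<Longrightarrow> b \<in> C \<Longrightarrow> a \<le> b \<or> b \<le> a"
      unfolding Chains_def relation_of_def by auto
    show "\<exists>u\<in>?A. \<forall>a\<in>C. ?P a u"
    proof (cases "C = {}")
      case True
      then show ?thesis using p by auto
    next
      case False
      let ?u = "\<lambda>x. INF q\<in>C. q x"
      have bdd: "bdd_below ((\<lambda>q. q x) ` C)" for x
      proof (rule bdd_belowI2)
        fix q assume "q \<in> C"
        then have "sublinear q" "q (- x) \<le> p (- x)" using CA by (auto simp: le_fun_def)
        then show "- p (- x) \<le> q x" using sublinear_ge_uminus[of q x] by linarith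
      qed
      have "sublinear ?u"
      proof (rule sublinear_INF[OF False bdd])
        fix q r x y assume qr: "q \<in> C" "r \<in> C"
        \<comment> \<open>The smaller of the two functionals serves both summands.\<close>
        then obtain k where k: "k \<in> C" "k \<le> q" "k \<le> r" using ch by blast
        have "k (x + y) \<le> k x + k y" using k(1) CA by (auto intro: sublinear_add)
        also have "\<dots> \<le> q x + r y" using k by (intro add_mono) (auto simp: le_fun_def)
        finally show "\<exists>k\<in>C. k (x + y) \<le> q x + r y" using k(1) by blast
      next
        fix q and c :: real and x assume "q \<in> C" "c > 0"
        then show "\<exists>k\<in>C. k (c *\<^sub>R x) \<le> c * q x"
          using CA by (intro bexI[of _ q]) (auto simp: sublinear_def)
      qed
      moreover have low: "?u \<le> a" if "a \<in> C" for a
        using cINF_lower[OF bdd that] by (simp add: le_fun_def)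
      moreover obtain a where "a \<in> C" using False by blast
      ultimately show ?thesis using CA by (intro bexI[of _ ?u]) (auto intro: order_trans)
    qed
  qed
  then obtain q where "sublinear q" "q \<le> p"
      and "\<And>r. sublinear r \<Longrightarrow> r \<le> p \<Longrightarrow> r \<le> q \<Longrightarrow> r = q" by blast
  then show thesis using that[of q] by (meson order_trans)
qed

text \<open>
  Minimality forces additivity: for each \<open>y\<close> the functional
  \<open>x \<mapsto> inf {q (x + t y) - t q y | t \<ge> 0}\<close> is sublinear and lies below \<open>q\<close>, hence equals \<open>q\<close>; the index
  \<open>t = 1\<close> then gives \<open>q x + q y \<le> q (x + y)\<close>.
\<close>

lemma minimal_sublinear_linear:
  fixes q :: "'a::real_vector \<Rightarrow> real"
  assumes q: "sublinear q" and min: "\<And>r. sublinear r \<Longrightarrow> r \<le> q \<Longrightarrow> r = q"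
  shows "linear q"
proof -
  have add: "q (x + y) = q x + q y" for x y
  proof -
    let ?F = "\<lambda>t x. q (x + t *\<^sub>R y) - t * q y"
    let ?r = "\<lambda>x. INF t\<in>{0..}. ?F t x"
    have bdd: "bdd_below ((\<lambda>t. ?F t x) ` {0..})" for x
    proof (rule bdd_belowI2)
      fix t :: real assume "t \<in> {0..}"
      then show "- q (- x) \<le> ?F t x"
        using sublinear_add[OF q, of "x + t *\<^sub>R y" "- x"] sublinear_scale[OF q, of t y] by simp
    qed
    have "sublinear ?r"
    proof (rule sublinear_INF[OF _ bdd])
      fix s t :: real and x z assume st: "s \<in> {0..}" "t \<in> {0..}"
      have "?F (s + t) (x + z) \<le> ?F s x + ?F t z"
        using sublinear_add[OF q, of "x + s *\<^sub>R y" "z + t *\<^sub>R y"] by (simp add: algebra_simps)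
      then show "\<exists>k\<in>{0..}. ?F k (x + z) \<le> ?F s x + ?F t z"
        using st by (intro bexI[of _ "s + t"]) auto
    next
      fix t c :: real and x assume "t \<in> {0..}" "c > 0"
      then show "\<exists>k\<in>{0..}. ?F k (c *\<^sub>R x) \<le> c * ?F t x"
        using sublinear_scale[OF q, of c "x + t *\<^sub>R y"]
        by (intro bexI[of _ "c * t"]) (auto simp: algebra_simps)
    qed simp
    moreover have "?r \<le> q"
    proof (rule le_funI)
      fix x show "?r x \<le> q x" using cINF_lower[OF bdd, of 0 x] by simp
    qed
    ultimately have "?r = q" by (rule min)
    then have "?r x = q x" by (rule fun_cong)
    then have "q x \<le> ?F 1 x" using cINF_lower[OF bdd, of 1 x] by simp
    then show ?thesis using sublinear_add[OF q, of x y] by simp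
  qed
  have neg: "q (- x) = - q x" for x
    using add[of x "- x"] sublinear_zero[OF q] by simp
  have "q (c *\<^sub>R x) = c * q x" for c x
  proof (cases "c \<ge> 0")
    case True
    then show ?thesis by (rule sublinear_scale[OF q])
  next
    case False
    then have "q ((- c) *\<^sub>R x) = - c * q x" by (intro sublinear_scale[OF q]) simp
    then show ?thesis using neg[of "c *\<^sub>R x"] by simp
  qed
  then show ?thesis using add by (intro linearI) simp_all
qed

lemma sublinear_dominates_linear:
  fixes p :: "'a::real_vector \<Rightarrow> real"
  assumes "sublinear p"
  obtains l where "linear l" "\<And>x. l x \<le> p x"
  using minimal_sublinear_exists[OF assms] minimal_sublinear_linear by (metis le_fun_def)

section \<open>Separation of a convex set from a ball\<close>

text \<open>
  A linear functional below \<open>p x = inf {norm (x + s c) - s d | s \<ge> 0, c \<in> D}\<close> has both required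
  properties at once: the index \<open>s = 0\<close> gives \<open>l \<le> norm\<close>, hence continuity, and \<open>s = 1\<close> at the point
  \<open>- c\<close> gives \<open>l (- c) \<le> - d\<close>. The distance assumption says exactly that \<open>p\<close> is finite.
\<close>

lemma convex_norm_functional:
  fixes D :: "'a::real_normed_vector set"
  assumes D: "convex D" and far: "\<And>c. c \<in> D \<Longrightarrow> d \<le> norm c"
  obtains l :: "'a \<Rightarrow>\<^sub>L real" where "\<And>c. c \<in> D \<Longrightarrow> d \<le> blinfun_apply l c"
proof (cases "D = {}")
  case True
  then show thesis using that by blast
next
  case False
  let ?I = "{0::real..} \<times> D"
  let ?F = "\<lambda>(s, c) x. norm (x + s *\<^sub>R c) - s * d"
  let ?p = "\<lambda>x. INF i\<in>?I. ?F i x"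
  have bdd: "bdd_below ((\<lambda>i. ?F i x) ` ?I)" for x
  proof (rule bdd_belowI2)
    fix i assume "i \<in> ?I"
    then obtain s c where i: "i = (s, c)" "s \<ge> 0" "c \<in> D" by auto
    have "s * d \<le> norm (s *\<^sub>R c)" using i far by (simp add: mult_left_mono)
    also have "\<dots> \<le> norm (x + s *\<^sub>R c) + norm x"
      using norm_triangle_ineq4[of "x + s *\<^sub>R c" x] by simp
    finally show "- norm x \<le> ?F i x" using i by simp
  qed
  have "sublinear ?p"
  proof (rule sublinear_INF[OF _ bdd])
    show "?I \<noteq> {}" using False by auto
  next
    fix i j x y assume "i \<in> ?I" "j \<in> ?I"
    then obtain s c t e where ij: "i = (s, c)" "j = (t, e)" "s \<ge> 0" "t \<ge> 0" "c \<in> D" "e \<in> D"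
      by auto
    \<comment> \<open>Convexity of \<open>D\<close>: the cone over \<open>D\<close> is closed under addition.\<close>
    obtain b where b: "b \<in> D" "(s + t) *\<^sub>R b = s *\<^sub>R c + t *\<^sub>R e"
    proof (cases "s + t = 0")
      case True
      then have "s = 0" "t = 0" using ij by linarith+
      then show thesis using that[OF \<open>c \<in> D\<close>] by simp
    next
      case False
      then have st: "s + t > 0" using ij by linarith
      have "(s / (s + t)) *\<^sub>R c + (t / (s + t)) *\<^sub>R e \<in> D"
        using D ij st by (intro convexD) (auto simp: add_divide_distrib[symmetric])
      then show thesis by (rule that) (use st in \<open>simp add: scaleR_add_right\<close>)
    qed
    have "norm (x + y + (s + t) *\<^sub>R b) \<le> norm (x + s *\<^sub>R c) + norm (y + t *\<^sub>R e)"
      using norm_triangle_ineq[of "x + s *\<^sub>R c" "y + t *\<^sub>R e"] b(2) by (simp add: algebra_simps)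
    then have "?F (s + t, b) (x + y) \<le> ?F i x + ?F j y"
      using ij by (simp add: algebra_simps)
    then show "\<exists>k\<in>?I. ?F k (x + y) \<le> ?F i x + ?F j y"
      using b(1) ij by (intro bexI[of _ "(s + t, b)"]) auto
  next
    fix i and k :: real and x assume "i \<in> ?I" and k: "k > 0"
    then obtain s c where i: "i = (s, c)" "s \<ge> 0" "c \<in> D" by auto
    have "k *\<^sub>R x + (k * s) *\<^sub>R c = k *\<^sub>R (x + s *\<^sub>R c)" by (simp add: scaleR_add_right)
    then have "norm (k *\<^sub>R x + (k * s) *\<^sub>R c) = k * norm (x + s *\<^sub>R c)" using k by simp
    then have "?F (k * s, c) (k *\<^sub>R x) \<le> k * ?F i x"
      using i by (simp add: algebra_simps)
    then show "\<exists>j\<in>?I. ?F j (k *\<^sub>R x) \<le> k * ?F i x"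
      using i k by (intro bexI[of _ "(k * s, c)"]) auto
  qed
  then obtain l where l: "linear l" "\<And>x. l x \<le> ?p x"
    by (rule sublinear_dominates_linear) (rule that)
  have lF: "l x \<le> norm (x + s *\<^sub>R c) - s * d" if "s \<ge> 0" "c \<in> D" for x s c
    using l(2)[of x] cINF_lower[OF bdd, of "(s, c)" x] that by auto
  obtain c0 where "c0 \<in> D" using False by blast
  then have le: "l x \<le> norm x" for x using lF[of 0 c0 x] by simp
  have "\<bar>l x\<bar> \<le> norm x" for x
    using le[of x] le[of "- x"] linear_neg[OF l(1), of x] by simp
  then have "bounded_linear l"
    using l(1) by (intro bounded_linear_intro[where K = 1])
      (auto simp: linear_add linear_scale)
  moreover have "d \<le> l c" if "c \<in> D" for c
    using lF[of 1 c "- c"] that linear_neg[OF l(1), of c] by simp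
  ultimately show thesis
    using that[of "Blinfun l"] by (simp add: bounded_linear_Blinfun_apply)
qed

section \<open>A mean value inequality for Dini derivatives\<close>

text \<open>
  For \<open>M' > M\<close>, the points of \<open>[a,b]\<close> at which \<open>\<phi>\<close> has grown at rate at most \<open>M'\<close> since \<open>a\<close> form a
  compact set. Its largest element must be \<open>b\<close>, because the Dini bound at an earlier point of the
  set yields further points of the set to its right.
\<close>

lemma upper_dini_mean_value:
  fixes \<phi> :: "real \<Rightarrow> real"
  assumes ab: "a \<le> b" and cont: "continuous_on {a..b} \<phi>"
    and dini: "\<And>t. a \<le> t \<Longrightarrow> t < b \<Longrightarrow> upper_dini \<phi> t 1 \<le> ereal M"
  shows "\<phi> b - \<phi> a \<le> M * (b - a)"
proof -
  have bound: "\<phi> b - \<phi> a \<le> M' * (b - a)" if M': "M < M'" for M'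
  proof -
    let ?A = "{t \<in> {a..b}. \<phi> t - M' * t \<le> \<phi> a - M' * a}"
    have "closed ?A"
      by (intro continuous_on_closed_Collect_le continuous_intros cont)
    moreover have "bounded ?A" by (rule bounded_subset[OF bounded_closed_interval[of a b]]) auto
    ultimately have "compact ?A" by (simp add: compact_eq_bounded_closed)
    moreover have "a \<in> ?A" using ab by simp
    ultimately obtain s where s: "s \<in> ?A" and smax: "\<And>t. t \<in> ?A \<Longrightarrow> t \<le> s"
      using compact_attains_sup[of ?A] by blast
    have "s = b"
    proof (rule ccontr)
      assume "s \<noteq> b"
      then have sb: "a \<le> s" "s < b" using s by auto
      have "upper_dini \<phi> s 1 < ereal M'"
        using dini[OF sb] M' by (simp add: le_less_trans)
      then have "\<forall>\<^sub>F t in at_right 0. (\<phi> (s + t) - \<phi> s) / t < M'"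
        unfolding upper_dini_def by (auto dest: Limsup_lessD)
      moreover have "\<forall>\<^sub>F t in at_right 0. t \<in> {0<..<b - s}"
        using sb by (intro eventually_at_right_real) simp
      ultimately have "\<forall>\<^sub>F t in at_right (0::real). (\<phi> (s + t) - \<phi> s) / t < M' \<and> t \<in> {0<..<b - s}"
        by (rule eventually_conj)
      then obtain t where t: "(\<phi> (s + t) - \<phi> s) / t < M'" "0 < t" "t < b - s"
        using eventually_happens[of _ "at_right (0::real)"] by fastforce
      then have "\<phi> (s + t) - \<phi> s < M' * t" by (simp add: field_simps)
      then have "s + t \<in> ?A" using s t by (auto simp: algebra_simps)
      then show False using smax[of "s + t"] t by simp
    qed
    then show ?thesis using s by (simp add: algebra_simps)
  qed
  show ?thesis
  proof (cases "a = b")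
    case True
    then show ?thesis by simp
  next
    case False
    then have pos: "b - a > 0" using ab by simp
    have "(\<phi> b - \<phi> a) / (b - a) \<le> M'" if "M < M'" for M'
      using bound[OF that] pos by (simp add: field_simps)
    then have "(\<phi> b - \<phi> a) / (b - a) \<le> M" by (rule dense_ge)
    then show ?thesis using pos by (simp add: field_simps)
  qed
qed

section \<open>The mean value theorem for pseudo-Jacobians\<close>

lemma upper_dini_along_line:
  "upper_dini (\<lambda>s. \<phi> (x + s *\<^sub>R d)) t 1 = upper_dini \<phi> (x + t *\<^sub>R d) d"
  by (simp add: upper_dini_def algebra_simps)

theorem theorem2p7:
  fixes U :: "'a::banach set"
    and f :: "'a \<Rightarrow> 'b::banach"
    and Jf :: "'a \<Rightarrow> ('a \<Rightarrow>\<^sub>L 'b) set"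
    and u v :: 'a
  assumes "open U"
    and "convex U"
    and "continuous_on U f"
    and "pseudo_jacobian_mapping U f Jf"
    and "u \<in> U"
    and "v \<in> U"
  shows "f v - f u \<in> closure (convex hull
           {blinfun_apply T (v - u) | T z. z \<in> closed_segment u v \<and> T \<in> Jf z})"
proof (rule ccontr)
  let ?S = "{blinfun_apply T (v - u) | T z. z \<in> closed_segment u v \<and> T \<in> Jf z}"
  let ?w = "f v - f u"
  assume "?w \<notin> closure (convex hull ?S)"
  then obtain d where d: "d > 0" and far: "\<And>k. k \<in> convex hull ?S \<Longrightarrow> d \<le> norm (?w - k)"
    unfolding closure_approachable by (force simp: not_less dist_norm norm_minus_commute)
  have "convex ((\<lambda>k. ?w - k) ` (convex hull ?S))"
    using convex_translation[OF convex_negations[OF convex_convex_hull[of ?S]], of ?w]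
    by (simp add: image_image)
  then obtain y :: "'b \<Rightarrow>\<^sub>L real" where y: "\<And>k. k \<in> convex hull ?S \<Longrightarrow> d \<le> y (?w - k)"
    by (rule convex_norm_functional[where d = d]) (use far in auto)
  define \<phi> where "\<phi> = (\<lambda>t. (blinfun_apply y \<circ> f) (u + t *\<^sub>R (v - u)))"
  have seg: "u + t *\<^sub>R (v - u) \<in> closed_segment u v" if "t \<in> {0..1}" for t
    using that by (auto simp: in_segment algebra_simps intro!: exI[of _ t])
  have segU: "closed_segment u v \<subseteq> U"
    using assms by (simp add: closed_segment_subset)
  have "\<phi> 1 - \<phi> 0 \<le> (y ?w - d) * (1 - 0)"
  proof (rule upper_dini_mean_value)
    have "continuous_on {0..1} (\<lambda>t. f (u + t *\<^sub>R (v - u)))"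
      by (rule continuous_on_compose2[OF assms(3)]) (use seg segU in \<open>auto intro!: continuous_intros\<close>)
    then show "continuous_on {0..1} \<phi>"
      unfolding \<phi>_def o_def by (intro continuous_intros)
  next
    fix t :: real assume t: "0 \<le> t" "t < 1"
    let ?z = "u + t *\<^sub>R (v - u)"
    have z: "?z \<in> closed_segment u v" using seg t by simp
    have "upper_dini \<phi> t 1 = upper_dini (blinfun_apply y \<circ> f) ?z (v - u)"
      unfolding \<phi>_def by (rule upper_dini_along_line)
    also have "\<dots> \<le> (SUP T\<in>Jf ?z. ereal (y (blinfun_apply T (v - u))))"
      using assms(4) z segU unfolding pseudo_jacobian_mapping_def pseudo_jacobian_def by blast
    also have "\<dots> \<le> ereal (y ?w - d)"
    proof (rule SUP_least)
      fix T assume "T \<in> Jf ?z"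
      then have "blinfun_apply T (v - u) \<in> convex hull ?S" using z by (intro hull_inc) blast
      from y[OF this] show "ereal (y (blinfun_apply T (v - u))) \<le> ereal (y ?w - d)"
        by (simp add: blinfun.diff_right)
    qed
    finally show "upper_dini \<phi> t 1 \<le> ereal (y ?w - d)" .
  qed simp
  then show False using d by (simp add: \<phi>_def blinfun.diff_right)
qed

end
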